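(* The category of cubical transition systems is a small-injectivity class of $\mathbf{WHDTS}$. More precisely, a weak HDTS $X$ is a cubical transition system if and only if it is injective with respect to the set of inclusions $C_n[x_1,\dots,x_n]^{ext}\subset C_n[x_1,\dots,x_n]$ and $\underline{x_1}\subset C_1[x_1]$ for all $n\ge 0$ and all $x_1,\dots,x_n\in\Sigma$.
   Context: Fix a nonempty set $\Sigma$ (of labels). A weak higher dimensional transition system (weak HDTS) is a triple $(S,\mu:L\to\Sigma,T=\bigcup_{n\ge 1}T_n)$ where $S$ is a set (states), $L$ a set (actions), $\mu$ a set map (labelling map), $T_n\subset S\times L^n\times S$ (the $n$-transitions) such that: (Multiset axiom) if $(\alpha,u_1,\dots,u_n,\beta)\in T$, $n\ge 2$, then $(\alpha,u_{\sigma(1)},\dots,u_{\sigma(n)},\beta)\in T$ for every permutation $\sigma$; (Coherence axiom) for $n\ge 3$, $p,q\ge 1$, $p+q<n$, if $(\alpha,u_1,\dots,u_n,\beta)$, $(\alpha,u_1,\dots,u_p,\nu_1)$, $(\nu_1,u_{p+1},\dots,u_n,\beta)$, $(\alpha,u_1,\dots,u_{p+q},\nu_2)$, $(\nu_2,u_{p+q+1},\dots,u_n,\beta)$ are all transitions, then $(\nu_1,u_{p+1},\dots,u_{p+q},\nu_2)$ is a transition. A map $f$ of weak HDTS consists of a map $f_0$ on states and a label-preserving map $\widetilde f$ on actions carrying transitions to transitions. The category is $\mathbf{WHDTS}$. For $x\in\Sigma$, $\underline{x}$ is the weak HDTS with no states, one action $x$ labelled by $x$, and no transitions. Write $0_n=(0,\dots,0)$,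 $1_n=(1,\dots,1)$ ($n$ entries; $0_0=1_0=()$). For $n\ge 0$, $x_1,\dots,x_n\in\Sigma$, the pure $n$-transition $C_n[x_1,\dots,x_n]^{ext}$ has states $\{0_n,1_n\}$, actions $(x_1,1),\dots,(x_n,n)$ with $\mu(x_i,i)=x_i$, and transitions all $(0_n,(x_{\sigma(1)},\sigma(1)),\dots,(x_{\sigma(n)},\sigma(n)),1_n)$ for $\sigma$ a permutation of $\{1,\dots,n\}$ (no transitions if $n=0$). The $n$-cube $C_n[x_1,\dots,x_n]$ has states $\{0,1\}^n$, the same actions and labelling, and transitions all tuples $((\epsilon_1,\dots,\epsilon_n),(x_{i_1},i_1),\dots,(x_{i_d},i_d),(\epsilon'_1,\dots,\epsilon'_n))$ with $d\geq 1$, $i_1,\dots,i_d$ pairwise distinct, $\epsilon_i\le\epsilon'_i$ for all $i$, and $\epsilon_i\ne\epsilon'_i$ iff $i\in\{i_1,\dots,i_d\}$. A cube of $X$ is a map $C_n[x_1,\dots,x_n]\to X$; a subcube of $X$ is the image of a cube of $X$ (the smallest subobject of $X$ through which it factors). Monomorphisms of $\mathbf{WHDTS}$ are the maps injective on states and on actions, and every family of subobjects of a weak HDTS has a union (least upper bound among subobjects). A weak HDTS is a cubical transition system if it equals the union of its subcubes. An object $X$ is injective with respect to a map $A\to B$ if every map $A\to X$ factors through $A\to B$. A small-injectivity class is the full subcategory of objects injective with respect to every map of some given set of maps. *)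

theory Defs
  imports "HOL-Library.FuncSet" "HOL-Combinatorics.Permutations"
begin

text \<open>The nonempty set \<open>\<Sigma>\<close> of labels is the type \<open>'l\<close>. The values of the labelling map outside the
  set of actions are irrelevant. An \<open>n\<close>-transition \<open>(\<alpha>, u\<^sub>1, \<dots>, u\<^sub>n, \<beta>)\<close> is the triple
  \<open>(\<alpha>, [u\<^sub>1, \<dots>, u\<^sub>n], \<beta>)\<close>.\<close>

record ('s, 'a, 'l) hdts =
  states :: "'s set"
  actions :: "'a set"
  label :: "'a \<Rightarrow> 'l"
  transitions :: "('s \<times> 'a list \<times> 's) set"

definition multiset_axiom :: "('s, 'a, 'l) hdts \<Rightarrow> bool" where
  "multiset_axiom X \<longleftrightarrow>
     (\<forall>\<alpha> us \<beta> \<sigma>. (\<alpha>, us, \<beta>) \<in> transitions X \<and> length us \<ge> 2 \<and> \<sigma> permutes {..<length us}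
        \<longrightarrow> (\<alpha>, permute_list \<sigma> us, \<beta>) \<in> transitions X)"

definition coherence_axiom :: "('s, 'a, 'l) hdts \<Rightarrow> bool" where
  "coherence_axiom X \<longleftrightarrow>
     (\<forall>\<alpha> us \<beta> \<nu>\<^sub>1 \<nu>\<^sub>2 p q.
        length us \<ge> 3 \<and> p \<ge> 1 \<and> q \<ge> 1 \<and> p + q < length us
        \<and> (\<alpha>, us, \<beta>) \<in> transitions X
        \<and> (\<alpha>, take p us, \<nu>\<^sub>1) \<in> transitions X
        \<and> (\<nu>\<^sub>1, drop p us, \<beta>) \<in> transitions X
        \<and> (\<alpha>, take (p + q) us, \<nu>\<^sub>2) \<in> transitions X
        \<and> (\<nu>\<^sub>2, drop (p + q) us, \<beta>) \<in> transitions X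
        \<longrightarrow> (\<nu>\<^sub>1, take q (drop p us), \<nu>\<^sub>2) \<in> transitions X)"

definition weak_hdts :: "('s, 'a, 'l) hdts \<Rightarrow> bool" where
  "weak_hdts X \<longleftrightarrow>
     transitions X \<subseteq> states X \<times> {us. us \<noteq> [] \<and> set us \<subseteq> actions X} \<times> states X
     \<and> multiset_axiom X \<and> coherence_axiom X"

text \<open>A map is a pair (map on states, map on actions); two pairs denote the same map
  iff they agree on the states and the actions of the source.\<close>

type_synonym ('s, 'a, 't, 'b) hdts_fun = "('s \<Rightarrow> 't) \<times> ('a \<Rightarrow> 'b)"

definition whdts_map ::
  "('s, 'a, 'l) hdts \<Rightarrow> ('t, 'b, 'l) hdts \<Rightarrow> ('s, 'a, 't, 'b) hdts_fun \<Rightarrow> bool" where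
  "whdts_map X Y f \<longleftrightarrow>
     weak_hdts X \<and> weak_hdts Y
     \<and> fst f \<in> states X \<rightarrow> states Y
     \<and> snd f \<in> actions X \<rightarrow> actions Y
     \<and> (\<forall>a\<in>actions X. label Y (snd f a) = label X a)
     \<and> (\<forall>(\<alpha>, us, \<beta>)\<in>transitions X. (fst f \<alpha>, map (snd f) us, fst f \<beta>) \<in> transitions Y)"


subsection \<open>Cubes, pure transitions, single actions\<close>

text \<open>The labels \<open>x\<^sub>1, \<dots>, x\<^sub>n\<close> form the list \<open>xs\<close> (so \<open>n = length xs\<close>); positions are counted from
  \<open>0\<close>, so that the actions are the pairs \<open>(xs ! i, i)\<close> with \<open>i < n\<close>. In states, \<open>False\<close> is \<open>0\<close>
  and \<open>True\<close> is \<open>1\<close>.\<close>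

definition cube_action :: "'l list \<Rightarrow> nat \<Rightarrow> 'l \<times> nat" where
  "cube_action xs i = (xs ! i, i)"

definition cube :: "'l list \<Rightarrow> (bool list, 'l \<times> nat, 'l) hdts" where
  "cube xs =
     \<lparr>states = {\<epsilon>. length \<epsilon> = length xs},
      actions = cube_action xs ` {..<length xs},
      label = fst,
      transitions =
        {(\<epsilon>, map (cube_action xs) js, \<epsilon>') | \<epsilon> js \<epsilon>'.
           length \<epsilon> = length xs \<and> length \<epsilon>' = length xs
           \<and> js \<noteq> [] \<and> distinct js \<and> set js \<subseteq> {..<length xs}
           \<and> (\<forall>i<length xs. \<epsilon> ! i \<le> \<epsilon>' ! i)
           \<and> (\<forall>i<length xs. \<epsilon> ! i \<noteq> \<epsilon>' ! i \<longleftrightarrow> i \<in> set js)}\<rparr>"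

definition pure_transition :: "'l list \<Rightarrow> (bool list, 'l \<times> nat, 'l) hdts" where
  "pure_transition xs =
     \<lparr>states = {replicate (length xs) False, replicate (length xs) True},
      actions = cube_action xs ` {..<length xs},
      label = fst,
      transitions =
        {(replicate (length xs) False,
          map (\<lambda>i. cube_action xs (\<sigma> i)) [0..<length xs],
          replicate (length xs) True) | \<sigma>.
           length xs \<ge> 1 \<and> \<sigma> permutes {..<length xs}}\<rparr>"

text \<open>The unique action is named as in \<open>cube [x]\<close>, so that \<open>single_action x\<close> is
  literally included in \<open>cube [x]\<close>.\<close>

definition single_action :: "'l \<Rightarrow> (bool list, 'l \<times> nat, 'l) hdts" where
  "single_action x =
     \<lparr>states = {}, actions = {cube_action [x] 0}, label = fst, transitions = {}\<rparr>"

definition inclusion :: "('s, 'a, 's, 'a) hdts_fun" where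
  "inclusion = (id, id)"


subsection \<open>Subobjects, images, unions, cubical transition systems\<close>

text \<open>Monomorphisms are the maps that are injective on states and on actions, so every subobject
  of \<open>X\<close> is represented by a weak HDTS whose inclusion into \<open>X\<close> is a map. The set
  of transitions need not be the full restriction of that of \<open>X\<close>. Mutual inclusion
  is equality of subobjects: the labels then agree on all actions.\<close>

definition subobject :: "('s, 'a, 'l) hdts \<Rightarrow> ('s, 'a, 'l) hdts \<Rightarrow> bool" where
  "subobject Y X \<longleftrightarrow>
     weak_hdts Y \<and> weak_hdts X
     \<and> states Y \<subseteq> states X \<and> actions Y \<subseteq> actions X \<and> transitions Y \<subseteq> transitions X
     \<and> (\<forall>a\<in>actions Y. label Y a = label X a)"

definition is_image ::
  "('s, 'a, 'l) hdts \<Rightarrow> ('t, 'b, 'l) hdts \<Rightarrow> ('s, 'a, 't, 'b) hdts_fun \<Rightarrow> ('t, 'b, 'l) hdts \<Rightarrow> bool" where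
  "is_image A X f Y \<longleftrightarrow>
     subobject Y X \<and> whdts_map A Y f
     \<and> (\<forall>Z. subobject Z X \<and> whdts_map A Z f \<longrightarrow> subobject Y Z)"

definition subcube :: "('s, 'a, 'l) hdts \<Rightarrow> ('s, 'a, 'l) hdts \<Rightarrow> bool" where
  "subcube Y X \<longleftrightarrow> (\<exists>xs f. whdts_map (cube xs) X f \<and> is_image (cube xs) X f Y)"

definition is_union ::
  "('s, 'a, 'l) hdts set \<Rightarrow> ('s, 'a, 'l) hdts \<Rightarrow> ('s, 'a, 'l) hdts \<Rightarrow> bool" where
  "is_union \<F> X U \<longleftrightarrow>
     subobject U X \<and> (\<forall>Y\<in>\<F>. subobject Y U)
     \<and> (\<forall>V. subobject V X \<and> (\<forall>Y\<in>\<F>. subobject Y V) \<longrightarrow> subobject U V)"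

definition cubical :: "('s, 'a, 'l) hdts \<Rightarrow> bool" where
  "cubical X \<longleftrightarrow> weak_hdts X \<and> is_union {Y. subcube Y X} X X"


subsection \<open>Injectivity\<close>

definition injective_wrt ::
  "('r, 'c, 'l) hdts \<Rightarrow> ('s, 'a, 'l) hdts \<Rightarrow> ('t, 'b, 'l) hdts \<Rightarrow> ('s, 'a, 't, 'b) hdts_fun \<Rightarrow> bool" where
  "injective_wrt X A B i \<longleftrightarrow>
     (\<forall>g. whdts_map A X g \<longrightarrow>
        (\<exists>h. whdts_map B X h
           \<and> (\<forall>s\<in>states A. fst h (fst i s) = fst g s)
           \<and> (\<forall>a\<in>actions A. snd h (snd i a) = snd g a)))"

text \<open>A full subcategory is given by its class of objects \<open>K\<close>. The set \<open>M\<close> consists of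
  triples (source, target, map). Its type does not involve the types of
  states and actions of the members of \<open>K\<close>, so the same set \<open>M\<close> can serve for all of them.\<close>

definition small_injectivity_class ::
  "(('s, 'a, 'l) hdts \<times> ('t, 'b, 'l) hdts \<times> ('s, 'a, 't, 'b) hdts_fun) set
     \<Rightarrow> ('r, 'c, 'l) hdts set \<Rightarrow> bool" where
  "small_injectivity_class M K \<longleftrightarrow>
     (\<forall>(A, B, i)\<in>M. whdts_map A B i)
     \<and> K = {X. weak_hdts X \<and> (\<forall>(A, B, i)\<in>M. injective_wrt X A B i)}"

definition cubical_generators ::
  "((bool list, 'l \<times> nat, 'l) hdts \<times> (bool list, 'l \<times> nat, 'l) hdts
     \<times> (bool list, 'l \<times> nat, bool list, 'l \<times> nat) hdts_fun) set" where
  "cubical_generators =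
     {(pure_transition xs, cube xs, inclusion) | xs. True}
     \<union> {(single_action x, cube [x], inclusion) | x. True}"

end

theory Submission
  imports Defs
begin

text \<open>An \<open>n\<close>-cube of \<open>X\<close> amounts to a family of states indexed by the subsets of an \<open>n\<close>-element
  index set, joined by all the expected transitions; call it a filler of the transition from
  its initial to its final state. The crucial point is that the transitions of \<open>X\<close> that have a
  filler are closed under the coherence axiom. A filler of \<open>(\<alpha>, u\<^sub>1, \<dots>, u\<^sub>n, \<beta>)\<close> need not pass through
  the given intermediate states \<open>\<nu>\<^sub>1\<close> and \<open>\<nu>\<^sub>2\<close>, but one may replace the two extreme corners of its
  face spanned by \<open>u\<close> with indices \<open>p + 1, \<dots>, p + q\<close> by \<open>\<nu>\<^sub>1\<close> and \<open>\<nu>\<^sub>2\<close>: every corner \<open>\<nu>\<close> of the modified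
  face still lies on a path of two transitions from \<open>\<alpha>\<close> to \<open>\<beta>\<close>, so the coherence axiom of \<open>X\<close>
  provides all the transitions between corners. Hence the transitions with a filler form a
  subobject that contains all subcubes, and this subobject is \<open>X\<close> if \<open>X\<close> is cubical.\<close>

section \<open>The axioms of a weak HDTS in terms of multisets and concatenations of lists\<close>

text \<open>Lists with the same multiset differ by a permutation. The multiset axiom is silent about
  lists of length below 2, but there the two lists coincide.\<close>

lemma weak_hdts_multiset:
  assumes "weak_hdts X" "(\<alpha>, us, \<beta>) \<in> transitions X" "mset vs = mset us"
  shows "(\<alpha>, vs, \<beta>) \<in> transitions X"
proof (cases "length us \<ge> 2")
  case True
  obtain p where "p permutes {..<length us}" "permute_list p us = vs"
    using mset_eq_permutation[OF assms(3)] by blast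
  then show ?thesis
    using assms(1,2) True unfolding weak_hdts_def multiset_axiom_def by blast
next
  case False
  have l: "length vs = length us" using assms(3) by (rule mset_eq_length)
  have "vs = us"
  proof (cases us)
    case Nil
    with l show ?thesis by simp
  next
    case (Cons a as)
    with False have "us = [a]" by (cases as) auto
    with assms(3) show ?thesis by simp
  qed
  with assms(2) show ?thesis by simp
qed

text \<open>Splitting the list as \<open>P @ Q @ R\<close> hides the arithmetic of
  \<open>p = length P\<close> and \<open>q = length Q\<close>; \<open>weak_hdtsI\<close> makes the
  same translation in the opposite direction.\<close>

lemma weak_hdts_coherence:
  assumes "weak_hdts X" "P \<noteq> []" "Q \<noteq> []" "R \<noteq> []"
    and "(\<alpha>, P @ Q @ R, \<beta>) \<in> transitions X"
    and "(\<alpha>, P, \<nu>\<^sub>1) \<in> transitions X" "(\<nu>\<^sub>1, Q @ R, \<beta>) \<in> transitions X"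
    and "(\<alpha>, P @ Q, \<nu>\<^sub>2) \<in> transitions X" "(\<nu>\<^sub>2, R, \<beta>) \<in> transitions X"
  shows "(\<nu>\<^sub>1, Q, \<nu>\<^sub>2) \<in> transitions X"
proof -
  have pos: "length P \<ge> 1" "length Q \<ge> 1" "length R \<ge> 1"
    using assms(2-4) by (simp_all add: Suc_le_eq)
  then have len: "length (P @ Q @ R) \<ge> 3" "length P + length Q < length (P @ Q @ R)"
    unfolding length_append by linarith+
  have coh: "coherence_axiom X" using assms(1) by (simp add: weak_hdts_def)
  have "(\<nu>\<^sub>1, take (length Q) (drop (length P) (P @ Q @ R)), \<nu>\<^sub>2) \<in> transitions X"
    by (rule coh[unfolded coherence_axiom_def, THEN spec[of _ \<alpha>], THEN spec[of _ "P @ Q @ R"],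
          THEN spec[of _ \<beta>], THEN spec[of _ \<nu>\<^sub>1], THEN spec[of _ \<nu>\<^sub>2], THEN spec[of _ "length P"],
          THEN spec[of _ "length Q"], THEN mp])
      (use pos len assms(5-9) in simp)
  then show ?thesis by simp
qed

lemma weak_hdtsI:
  assumes "\<And>\<alpha> us \<beta>. (\<alpha>, us, \<beta>) \<in> transitions X \<Longrightarrow>
      \<alpha> \<in> states X \<and> us \<noteq> [] \<and> set us \<subseteq> actions X \<and> \<beta> \<in> states X"
    and "\<And>\<alpha> us \<beta> \<sigma>. (\<alpha>, us, \<beta>) \<in> transitions X \<Longrightarrow> \<sigma> permutes {..<length us} \<Longrightarrow>
      (\<alpha>, permute_list \<sigma> us, \<beta>) \<in> transitions X"
    and "\<And>\<alpha> P Q R \<beta> \<nu>\<^sub>1 \<nu>\<^sub>2. P \<noteq> [] \<Longrightarrow> Q \<noteq> [] \<Longrightarrow> R \<noteq> [] \<Longrightarrow>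
      (\<alpha>, P @ Q @ R, \<beta>) \<in> transitions X \<Longrightarrow>
      (\<alpha>, P, \<nu>\<^sub>1) \<in> transitions X \<Longrightarrow> (\<nu>\<^sub>1, Q @ R, \<beta>) \<in> transitions X \<Longrightarrow>
      (\<alpha>, P @ Q, \<nu>\<^sub>2) \<in> transitions X \<Longrightarrow> (\<nu>\<^sub>2, R, \<beta>) \<in> transitions X \<Longrightarrow>
      (\<nu>\<^sub>1, Q, \<nu>\<^sub>2) \<in> transitions X"
  shows "weak_hdts X"
  unfolding weak_hdts_def
proof (intro conjI)
  show "transitions X \<subseteq> states X \<times> {us. us \<noteq> [] \<and> set us \<subseteq> actions X} \<times> states X"
    using assms(1) by fast
  show "multiset_axiom X"
    using assms(2) unfolding multiset_axiom_def by blast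
  show "coherence_axiom X"
    unfolding coherence_axiom_def
  proof (intro allI impI, elim conjE)
    fix \<alpha> us \<beta> \<nu>\<^sub>1 \<nu>\<^sub>2 and p q :: nat
    assume *: "length us \<ge> 3" "p \<ge> 1" "q \<ge> 1" "p + q < length us"
      "(\<alpha>, us, \<beta>) \<in> transitions X"
      "(\<alpha>, take p us, \<nu>\<^sub>1) \<in> transitions X" "(\<nu>\<^sub>1, drop p us, \<beta>) \<in> transitions X"
      "(\<alpha>, take (p + q) us, \<nu>\<^sub>2) \<in> transitions X" "(\<nu>\<^sub>2, drop (p + q) us, \<beta>) \<in> transitions X"
    define P Q R where "P = take p us" and "Q = take q (drop p us)" and "R = drop (p + q) us"
    have QR: "Q @ R = drop p us"
      unfolding Q_def R_def by (metis add.commute append_take_drop_id drop_drop)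
    have PQ: "P @ Q = take (p + q) us"
      unfolding P_def Q_def by (simp add: take_add)
    have "P @ Q @ R = us" using QR by (simp add: P_def)
    moreover have "P \<noteq> []" "Q \<noteq> []" "R \<noteq> []"
      using * by (auto simp: P_def Q_def R_def)
    ultimately show "(\<nu>\<^sub>1, take q (drop p us), \<nu>\<^sub>2) \<in> transitions X"
      using assms(3)[of P Q R \<alpha> \<beta> \<nu>\<^sub>1 \<nu>\<^sub>2] * QR PQ by (simp add: P_def Q_def R_def)
  qed
qed

lemma whdts_mapI:
  assumes "weak_hdts X" "weak_hdts Y"
    and "\<And>s. s \<in> states X \<Longrightarrow> fst f s \<in> states Y"
    and "\<And>a. a \<in> actions X \<Longrightarrow> snd f a \<in> actions Y \<and> label Y (snd f a) = label X a"
    and "\<And>\<alpha> us \<beta>. (\<alpha>, us, \<beta>) \<in> transitions X \<Longrightarrow>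
      (fst f \<alpha>, map (snd f) us, fst f \<beta>) \<in> transitions Y"
  shows "whdts_map X Y f"
  using assms unfolding whdts_map_def by auto

lemma whdts_mapD:
  assumes "whdts_map X Y f"
  shows "weak_hdts X" "weak_hdts Y"
    and "s \<in> states X \<Longrightarrow> fst f s \<in> states Y"
    and "a \<in> actions X \<Longrightarrow> snd f a \<in> actions Y"
    and "a \<in> actions X \<Longrightarrow> label Y (snd f a) = label X a"
    and "(\<alpha>, us, \<beta>) \<in> transitions X \<Longrightarrow> (fst f \<alpha>, map (snd f) us, fst f \<beta>) \<in> transitions Y"
  using assms unfolding whdts_map_def by auto

lemma weak_hdts_transitionD:
  assumes "weak_hdts X" "(\<alpha>, us, \<beta>) \<in> transitions X"
  shows "\<alpha> \<in> states X" "us \<noteq> []" "set us \<subseteq> actions X" "\<beta> \<in> states X"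
  using assms unfolding weak_hdts_def by auto


subsection \<open>Cubes, pure transitions, single actions\<close>

lemma cube_simps [simp]:
  "states (cube xs) = {\<epsilon>. length \<epsilon> = length xs}"
  "actions (cube xs) = cube_action xs ` {..<length xs}"
  "label (cube xs) = fst"
  by (simp_all add: cube_def)

lemma pure_transition_simps [simp]:
  "states (pure_transition xs) = {replicate (length xs) False, replicate (length xs) True}"
  "actions (pure_transition xs) = cube_action xs ` {..<length xs}"
  "label (pure_transition xs) = fst"
  by (simp_all add: pure_transition_def)

lemma single_action_simps [simp]:
  "states (single_action x) = {}"
  "actions (single_action x) = {cube_action [x] 0}"
  "label (single_action x) = fst"
  "transitions (single_action x) = {}"
  by (simp_all add: single_action_def)

lemma fst_cube_action [simp]: "fst (cube_action xs i) = xs ! i"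
  by (simp add: cube_action_def)

lemma pure_transition_transition_iff:
  "(\<alpha>, us, \<beta>) \<in> transitions (pure_transition xs) \<longleftrightarrow>
     (\<exists>\<sigma>. us = map (\<lambda>i. cube_action xs (\<sigma> i)) [0..<length xs] \<and> \<sigma> permutes {..<length xs}
       \<and> xs \<noteq> [] \<and> \<alpha> = replicate (length xs) False \<and> \<beta> = replicate (length xs) True)"
  unfolding pure_transition_def by (auto simp: Suc_le_eq)

lemma cube_transition_iff:
  "(\<epsilon>, us, \<epsilon>') \<in> transitions (cube xs) \<longleftrightarrow>
     (\<exists>js. us = map (cube_action xs) js \<and> length \<epsilon> = length xs \<and> length \<epsilon>' = length xs
       \<and> js \<noteq> [] \<and> distinct js \<and> set js \<subseteq> {..<length xs}
       \<and> (\<forall>i<length xs. \<epsilon> ! i \<le> \<epsilon>' ! i)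
       \<and> (\<forall>i<length xs. \<epsilon> ! i \<noteq> \<epsilon>' ! i \<longleftrightarrow> i \<in> set js))"
  unfolding cube_def by auto

lemma inj_cube_action: "inj (cube_action xs)"
  by (auto simp: inj_def cube_action_def)

lemma map_append_eqE:
  assumes "map f xs = ys @ zs"
  obtains ys' zs' where "xs = ys' @ zs'" "map f ys' = ys" "map f zs' = zs"
  using assms by (auto simp: map_eq_append_conv)

lemma weak_hdts_cube: "weak_hdts (cube xs)"
proof (rule weak_hdtsI)
  fix \<alpha> us \<beta> assume "(\<alpha>, us, \<beta>) \<in> transitions (cube xs)"
  then show "\<alpha> \<in> states (cube xs) \<and> us \<noteq> [] \<and> set us \<subseteq> actions (cube xs) \<and> \<beta> \<in> states (cube xs)"
    unfolding cube_transition_iff by (auto simp: subset_iff intro!: imageI)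
next
  fix \<alpha> us \<beta> \<sigma>
  assume tr: "(\<alpha>, us, \<beta>) \<in> transitions (cube xs)" and \<sigma>: "\<sigma> permutes {..<length us}"
  from tr obtain js where js: "us = map (cube_action xs) js" "length \<alpha> = length xs"
    "length \<beta> = length xs" "js \<noteq> []" "distinct js" "set js \<subseteq> {..<length xs}"
    "\<forall>i<length xs. \<alpha> ! i \<le> \<beta> ! i" "\<forall>i<length xs. \<alpha> ! i \<noteq> \<beta> ! i \<longleftrightarrow> i \<in> set js"
    unfolding cube_transition_iff by blast
  from \<sigma> js(1) have \<sigma>': "\<sigma> permutes {..<length js}" by simp
  have "permute_list \<sigma> js \<noteq> []" using js(4) by (metis length_permute_list length_0_conv)
  moreover have "permute_list \<sigma> us = map (cube_action xs) (permute_list \<sigma> js)"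
    using \<sigma>' js(1) by (simp add: permute_list_map)
  ultimately show "(\<alpha>, permute_list \<sigma> us, \<beta>) \<in> transitions (cube xs)"
    unfolding cube_transition_iff
    using js(2-) set_permute_list[OF \<sigma>'] distinct_permute_list[OF \<sigma>'] by metis
next
  fix \<alpha> P Q R \<beta> \<nu>\<^sub>1 \<nu>\<^sub>2
  assume ne: "P \<noteq> []" "Q \<noteq> []" "R \<noteq> []"
    and all: "(\<alpha>, P @ Q @ R, \<beta>) \<in> transitions (cube xs)"
    and P: "(\<alpha>, P, \<nu>\<^sub>1) \<in> transitions (cube xs)" and PQ: "(\<alpha>, P @ Q, \<nu>\<^sub>2) \<in> transitions (cube xs)"
  from all obtain js where js: "map (cube_action xs) js = P @ Q @ R" "distinct js"
    "set js \<subseteq> {..<length xs}"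
    unfolding cube_transition_iff by auto
  from js(1) obtain p q r where pqr: "js = p @ q @ r" "P = map (cube_action xs) p"
    "Q = map (cube_action xs) q" "R = map (cube_action xs) r"
    by (metis map_append_eqE)
  \<comment> \<open>Since \<open>cube_action xs\<close> is injective, the index list hidden in a
    transition of the cube can only be \<open>ks\<close>.\<close>
  have lift: "length \<epsilon> = length xs \<and> length \<epsilon>' = length xs \<and> (\<forall>i<length xs. \<epsilon> ! i \<le> \<epsilon>' ! i)
      \<and> (\<forall>i<length xs. \<epsilon> ! i \<noteq> \<epsilon>' ! i \<longleftrightarrow> i \<in> set ks)"
    if "(\<epsilon>, map (cube_action xs) ks, \<epsilon>') \<in> transitions (cube xs)" for \<epsilon> \<epsilon>' ks
    using that unfolding cube_transition_iff by (auto simp: inj_map_eq_map[OF inj_cube_action])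
  note P' = lift[OF P[unfolded pqr(2)]]
  note PQ' = lift[OF PQ[unfolded pqr(2,3) map_append[symmetric]]]
  have "\<nu>\<^sub>1 ! i \<le> \<nu>\<^sub>2 ! i \<and> (\<nu>\<^sub>1 ! i \<noteq> \<nu>\<^sub>2 ! i \<longleftrightarrow> i \<in> set q)" if i: "i < length xs" for i
  proof -
    have "i \<in> set p \<Longrightarrow> i \<notin> set q" using js(2) pqr(1) by auto
    then show ?thesis
      using P' PQ' i by (cases "i \<in> set p"; cases "i \<in> set q"; cases "\<alpha> ! i"; cases "\<nu>\<^sub>1 ! i"; cases "\<nu>\<^sub>2 ! i") auto
  qed
  moreover have "q \<noteq> []" "distinct q" "set q \<subseteq> {..<length xs}"
    using ne js pqr by auto
  ultimately show "(\<nu>\<^sub>1, Q, \<nu>\<^sub>2) \<in> transitions (cube xs)"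
    unfolding cube_transition_iff using P' PQ' pqr(3) by blast
qed

lemma weak_hdts_pure_transition: "weak_hdts (pure_transition xs)"
proof (rule weak_hdtsI)
  fix \<alpha> us \<beta> assume "(\<alpha>, us, \<beta>) \<in> transitions (pure_transition xs)"
  then show "\<alpha> \<in> states (pure_transition xs) \<and> us \<noteq> [] \<and> set us \<subseteq> actions (pure_transition xs)
      \<and> \<beta> \<in> states (pure_transition xs)"
    unfolding pure_transition_transition_iff
    by (auto simp: permutes_in_image simp flip: lessThan_iff)
next
  fix \<alpha> us \<beta> \<tau>
  assume tr: "(\<alpha>, us, \<beta>) \<in> transitions (pure_transition xs)" and \<tau>: "\<tau> permutes {..<length us}"
  then obtain \<sigma> where \<sigma>: "us = map (\<lambda>i. cube_action xs (\<sigma> i)) [0..<length xs]"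
    "\<sigma> permutes {..<length xs}" "xs \<noteq> []"
    "\<alpha> = replicate (length xs) False" "\<beta> = replicate (length xs) True"
    unfolding pure_transition_transition_iff by blast
  from \<tau> \<sigma>(1) have \<tau>': "\<tau> permutes {..<length xs}" by simp
  have "permute_list \<tau> us = map (\<lambda>i. cube_action xs ((\<sigma> \<circ> \<tau>) i)) [0..<length xs]"
    unfolding permute_list_def using \<sigma>(1) permutes_in_image[OF \<tau>'] by (auto intro!: nth_equalityI)
  moreover have "\<sigma> \<circ> \<tau> permutes {..<length xs}" using \<tau>' \<sigma>(2) by (rule permutes_compose)
  ultimately show "(\<alpha>, permute_list \<tau> us, \<beta>) \<in> transitions (pure_transition xs)"
    using \<sigma>(3-5) unfolding pure_transition_transition_iff by blast
next
  fix \<alpha> P Q R \<beta> \<nu>\<^sub>1 \<nu>\<^sub>2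
  assume "Q \<noteq> []" "(\<alpha>, P @ Q @ R, \<beta>) \<in> transitions (pure_transition xs)"
    "(\<alpha>, P, \<nu>\<^sub>1) \<in> transitions (pure_transition xs)"
  moreover have "length us = length xs" if "(\<gamma>, us, \<delta>) \<in> transitions (pure_transition xs)" for \<gamma> us \<delta>
    using that unfolding pure_transition_transition_iff by auto
  \<comment> \<open>Coherence holds vacuously: all transitions have length \<open>length xs\<close>,
    whereas \<open>P\<close> is strictly shorter than \<open>P @ Q @ R\<close>.\<close>
  ultimately have False by (metis add_cancel_right_right append_is_Nil_conv length_0_conv length_append)
  then show "(\<nu>\<^sub>1, Q, \<nu>\<^sub>2) \<in> transitions (pure_transition xs)" ..
qed

lemma whdts_map_pure_transition_inclusion:
  "whdts_map (pure_transition xs) (cube xs) inclusion"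
proof (rule whdts_mapI[OF weak_hdts_pure_transition weak_hdts_cube])
  fix \<alpha> us \<beta> assume "(\<alpha>, us, \<beta>) \<in> transitions (pure_transition xs)"
  then obtain \<sigma> where \<sigma>: "us = map (\<lambda>i. cube_action xs (\<sigma> i)) [0..<length xs]"
    "\<sigma> permutes {..<length xs}" "xs \<noteq> []"
    "\<alpha> = replicate (length xs) False" "\<beta> = replicate (length xs) True"
    unfolding pure_transition_transition_iff by blast
  have "set (map \<sigma> [0..<length xs]) = {..<length xs}"
    using permutes_image[OF \<sigma>(2)] by (simp add: atLeast0LessThan)
  moreover have "distinct (map \<sigma> [0..<length xs])"
    using permutes_inj_on[OF \<sigma>(2)] by (simp add: distinct_map)
  ultimately have "(\<alpha>, us, \<beta>) \<in> transitions (cube xs)"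
    unfolding cube_transition_iff using \<sigma>
    by (intro exI[of _ "map \<sigma> [0..<length xs]"]) auto
  then show "(fst inclusion \<alpha>, map (snd inclusion) us, fst inclusion \<beta>) \<in> transitions (cube xs)"
    by (simp add: inclusion_def)
qed (auto simp: inclusion_def)

lemma weak_hdts_single_action: "weak_hdts (single_action x)"
  by (rule weak_hdtsI) auto

lemma whdts_map_single_action_inclusion: "whdts_map (single_action x) (cube [x]) inclusion"
  by (rule whdts_mapI[OF weak_hdts_single_action weak_hdts_cube])
    (auto simp: inclusion_def cube_action_def)


subsection \<open>Images and unions of subcubes\<close>

lemma subobject_refl: "weak_hdts X \<Longrightarrow> subobject X X"
  by (simp add: subobject_def)

lemma whdts_map_subobject:
  assumes "whdts_map A Y f" "subobject Y Z"
  shows "whdts_map A Z f"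
  using assms unfolding whdts_map_def subobject_def by (fastforce simp: Pi_iff subset_iff)

text \<open>The image is the intersection of all subobjects through which \<open>f\<close> factors.
  The axioms only derive transitions from transitions, so they survive intersections; the family is
  nonempty because it contains \<open>X\<close>.\<close>

lemma ex_image:
  assumes f: "whdts_map A X f"
  shows "\<exists>Y. is_image A X f Y"
proof -
  define F where "F = {Z. subobject Z X \<and> whdts_map A Z f}"
  define Y where "Y = \<lparr>states = \<Inter>(states ` F), actions = \<Inter>(actions ` F), label = label X,
      transitions = \<Inter>(transitions ` F)\<rparr>"
  have X: "X \<in> F" and wX: "weak_hdts X"
    using f subobject_refl[of X] by (auto simp: F_def whdts_map_def)
  have w: "weak_hdts Z" if "Z \<in> F" for Z
    using that by (simp add: F_def subobject_def)
  have wY: "weak_hdts Y"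
  proof (rule weak_hdtsI)
    fix \<alpha> us \<beta> assume "(\<alpha>, us, \<beta>) \<in> transitions Y"
    then have tr: "(\<alpha>, us, \<beta>) \<in> transitions Z" if "Z \<in> F" for Z
      using that by (auto simp: Y_def)
    show "\<alpha> \<in> states Y \<and> us \<noteq> [] \<and> set us \<subseteq> actions Y \<and> \<beta> \<in> states Y"
      using weak_hdts_transitionD[OF w tr] X unfolding Y_def by auto
  next
    fix \<alpha> us \<beta> \<sigma> assume "(\<alpha>, us, \<beta>) \<in> transitions Y" "\<sigma> permutes {..<length us}"
    then show "(\<alpha>, permute_list \<sigma> us, \<beta>) \<in> transitions Y"
      using weak_hdts_multiset[OF w] mset_permute_list unfolding Y_def by fastforce
  next
    fix \<alpha> P Q R \<beta> \<nu>\<^sub>1 \<nu>\<^sub>2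
    assume "P \<noteq> []" "Q \<noteq> []" "R \<noteq> []"
      "(\<alpha>, P @ Q @ R, \<beta>) \<in> transitions Y"
      "(\<alpha>, P, \<nu>\<^sub>1) \<in> transitions Y" "(\<nu>\<^sub>1, Q @ R, \<beta>) \<in> transitions Y"
      "(\<alpha>, P @ Q, \<nu>\<^sub>2) \<in> transitions Y" "(\<nu>\<^sub>2, R, \<beta>) \<in> transitions Y"
    then show "(\<nu>\<^sub>1, Q, \<nu>\<^sub>2) \<in> transitions Y"
      using weak_hdts_coherence[OF w, of _ P Q R \<alpha> \<beta> \<nu>\<^sub>1 \<nu>\<^sub>2] unfolding Y_def by simp
  qed
  have sub: "subobject Y Z" if "Z \<in> F" for Z
    using that w[OF that] wY unfolding subobject_def by (auto simp: Y_def F_def subobject_def)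
  have "whdts_map A Y f"
    using f wY unfolding whdts_map_def
    by (auto simp: Y_def F_def whdts_map_def split: prod.splits)
  with sub[OF X] sub show ?thesis
    unfolding is_image_def F_def by blast
qed

text \<open>Images can be traded for maps: a subobject contains the image of a cube iff the cube
  factors through it. As \<open>X\<close> is an upper bound of its subcubes anyway, only minimality
  is at stake.\<close>

lemma cubical_iff:
  assumes X: "weak_hdts X"
  shows "cubical X \<longleftrightarrow>
    (\<forall>V. subobject V X \<and> (\<forall>xs f. whdts_map (cube xs) X f \<longrightarrow> whdts_map (cube xs) V f)
       \<longrightarrow> subobject X V)"
proof -
  have "(\<forall>Y. subcube Y X \<longrightarrow> subobject Y V) \<longleftrightarrow>
      (\<forall>xs f. whdts_map (cube xs) X f \<longrightarrow> whdts_map (cube xs) V f)" if "subobject V X" for V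
  proof (intro iffI allI impI)
    fix xs f assume *: "\<forall>Y. subcube Y X \<longrightarrow> subobject Y V" "whdts_map (cube xs) X f"
    then obtain Y where "is_image (cube xs) X f Y" using ex_image by blast
    with * show "whdts_map (cube xs) V f"
      unfolding subcube_def is_image_def by (metis whdts_map_subobject)
  next
    fix Y assume "\<forall>xs f. whdts_map (cube xs) X f \<longrightarrow> whdts_map (cube xs) V f" "subcube Y X"
    with that show "subobject Y V" unfolding subcube_def is_image_def by blast
  qed
  moreover have "cubical X \<longleftrightarrow>
      (\<forall>V. subobject V X \<and> (\<forall>Y. subcube Y X \<longrightarrow> subobject Y V) \<longrightarrow> subobject X V)"
  proof -
    have "\<forall>Y. subcube Y X \<longrightarrow> subobject Y X" unfolding subcube_def is_image_def by blast
    with X subobject_refl[OF X] show ?thesis unfolding cubical_def is_union_def by simp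
  qed
  ultimately show ?thesis by (simp cong: conj_cong)
qed


subsection \<open>Fillers\<close>

text \<open>A subset \<open>A\<close> stands for the vertex whose coordinates equal to 1 are those
  in \<open>A\<close>, and \<open>u j\<close> is the action in direction \<open>j\<close>. For empty
  \<open>I\<close> this is a 0-cube: one state and no transition.\<close>

definition filler :: "('s, 'a, 'l) hdts \<Rightarrow> nat set \<Rightarrow> (nat \<Rightarrow> 'a) \<Rightarrow> (nat set \<Rightarrow> 's) \<Rightarrow> bool" where
  "filler X I u c \<longleftrightarrow>
     (\<forall>A\<subseteq>I. c A \<in> states X)
     \<and> (\<forall>A ks. A \<subseteq> I \<and> ks \<noteq> [] \<and> distinct ks \<and> set ks \<subseteq> I - A
          \<longrightarrow> (c A, map u ks, c (A \<union> set ks)) \<in> transitions X)"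

text \<open>Indexing by an arbitrary distinct list \<open>js\<close>, rather than by the positions of \<open>us\<close>, makes
  invariance under permutations and passing to faces immediate.\<close>

definition fillable :: "('s, 'a, 'l) hdts \<Rightarrow> 's \<Rightarrow> 'a list \<Rightarrow> 's \<Rightarrow> bool" where
  "fillable X \<alpha> us \<beta> \<longleftrightarrow>
     (\<exists>js u c. js \<noteq> [] \<and> distinct js \<and> us = map u js \<and> filler X (set js) u c
        \<and> c {} = \<alpha> \<and> c (set js) = \<beta>)"

lemma filler_transition:
  assumes "filler X I u c" "A \<subseteq> I" "ks \<noteq> []" "distinct ks" "set ks \<subseteq> I - A" "B = A \<union> set ks"
  shows "(c A, map u ks, c B) \<in> transitions X"
  using assms unfolding filler_def by blast

lemma fillable_transition: "fillable X \<alpha> us \<beta> \<Longrightarrow> (\<alpha>, us, \<beta>) \<in> transitions X"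
  unfolding fillable_def by (auto intro!: filler_transition)

lemma fillable_permute:
  assumes "fillable X \<alpha> us \<beta>" "\<sigma> permutes {..<length us}"
  shows "fillable X \<alpha> (permute_list \<sigma> us) \<beta>"
proof -
  from assms(1) obtain js u c where js: "js \<noteq> []" "distinct js" "us = map u js"
    "filler X (set js) u c" "c {} = \<alpha>" "c (set js) = \<beta>"
    unfolding fillable_def by blast
  from assms(2) js(3) have \<sigma>: "\<sigma> permutes {..<length js}" by simp
  have "permute_list \<sigma> js \<noteq> []" using js(1) by (metis length_permute_list length_0_conv)
  then show ?thesis
    unfolding fillable_def
    using js set_permute_list[OF \<sigma>] distinct_permute_list[OF \<sigma>] permute_list_map[OF \<sigma>] by metis
qed

text \<open>The directions \<open>ks\<close> at the corner \<open>A\<close> span a face, whose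
  corners are the \<open>A \<union> D\<close> with \<open>D \<subseteq> set ks\<close>; this face is
  itself a filler.\<close>

lemma fillable_face:
  assumes "filler X I u c" "A \<subseteq> I" "ks \<noteq> []" "distinct ks" "set ks \<subseteq> I - A" "B = A \<union> set ks"
  shows "fillable X (c A) (map u ks) (c B)"
proof -
  have "filler X (set ks) u (\<lambda>D. c (A \<union> D))"
    unfolding filler_def
  proof (intro conjI allI impI)
    fix D assume "D \<subseteq> set ks"
    then have "A \<union> D \<subseteq> I" using assms(2,5) by blast
    then show "c (A \<union> D) \<in> states X" using assms(1) unfolding filler_def by blast
  next
    fix D ls assume "D \<subseteq> set ks \<and> ls \<noteq> [] \<and> distinct ls \<and> set ls \<subseteq> set ks - D"
    then show "(c (A \<union> D), map u ls, c (A \<union> (D \<union> set ls))) \<in> transitions X"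
      by (intro filler_transition[OF assms(1)]) (use assms in auto)
  qed
  with assms(3,4,6) show ?thesis
    unfolding fillable_def by (intro exI[of _ ks] exI[of _ u] exI[of _ "\<lambda>D. c (A \<union> D)"]) simp
qed

text \<open>A 1-cube consists of two corners and one edge, so a 1-transition is its own
  filler.\<close>

lemma fillable_single_transition:
  assumes "weak_hdts X" "(\<alpha>, [a], \<beta>) \<in> transitions X"
  shows "fillable X \<alpha> [a] \<beta>"
proof -
  have "filler X {0} (\<lambda>_. a) (\<lambda>A. if A = {} then \<alpha> else \<beta>)"
    unfolding filler_def
  proof (intro conjI allI impI)
    fix A :: "nat set" and ks :: "nat list"
    assume *: "A \<subseteq> {0} \<and> ks \<noteq> [] \<and> distinct ks \<and> set ks \<subseteq> {0} - A"
    then have "A = {}" by (cases ks) auto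
    moreover have "ks = [0]"
      using * by (cases ks; cases "tl ks") auto
    ultimately show "(if A = {} then \<alpha> else \<beta>, map (\<lambda>_. a) ks,
        if A \<union> set ks = {} then \<alpha> else \<beta>) \<in> transitions X"
      using assms(2) by simp
  qed (use weak_hdts_transitionD[OF assms] in auto)
  then show ?thesis
    unfolding fillable_def
    by (intro exI[of _ "[0]"] exI[of _ "\<lambda>_. a"] exI[of _ "\<lambda>A. if A = {} then \<alpha> else \<beta>"]) simp
qed

text \<open>Of the five premises of coherence only the full transition comes with a filler. The
  other four are mere transitions of \<open>X\<close>, used to attach \<open>\<nu>\<^sub>1\<close>
  and \<open>\<nu>\<^sub>2\<close> as new corners.\<close>

lemma fillable_coherence:
  assumes X: "weak_hdts X" and ne: "P \<noteq> []" "Q \<noteq> []" "R \<noteq> []"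
    and fill: "fillable X \<alpha> (P @ Q @ R) \<beta>"
    and P: "(\<alpha>, P, \<nu>\<^sub>1) \<in> transitions X" and QR: "(\<nu>\<^sub>1, Q @ R, \<beta>) \<in> transitions X"
    and PQ: "(\<alpha>, P @ Q, \<nu>\<^sub>2) \<in> transitions X" and R: "(\<nu>\<^sub>2, R, \<beta>) \<in> transitions X"
  shows "fillable X \<nu>\<^sub>1 Q \<nu>\<^sub>2"
proof -
  from fill obtain js u c where js: "distinct js" "map u js = P @ Q @ R"
    "filler X (set js) u c" and ends: "c {} = \<alpha>" "c (set js) = \<beta>"
    unfolding fillable_def by metis
  from js(2) obtain p q r where pqr: "js = p @ q @ r" "P = map u p" "Q = map u q" "R = map u r"
    by (metis map_append_eqE)
  have ne': "p \<noteq> []" "q \<noteq> []" "r \<noteq> []" using ne pqr by auto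
  \<comment> \<open>The face spanned by \<open>q\<close> at the corner \<open>set p\<close>, with
    its two extreme corners replaced. They are distinct because \<open>q\<close> is
    nonempty.\<close>
  define e where "e A = (if A = {} then \<nu>\<^sub>1 else if A = set q then \<nu>\<^sub>2 else c (set p \<union> A))" for A
  \<comment> \<open>The path from \<alpha> to \<beta> through the corner \<open>set a\<close>; the
    lists \<open>a\<close> and \<open>b\<close> enumerate this corner and its complement in
    \<open>q\<close>, in any order.\<close>
  have through: "(\<alpha>, map u (p @ a), e (set a)) \<in> transitions X \<and>
      (e (set a), map u (b @ r), \<beta>) \<in> transitions X"
    if ab: "distinct (a @ b)" "set (a @ b) = set q" for a b
  proof -
    have m: "mset (a @ b) = mset q"
      using ab js(1) pqr(1) by (subst set_eq_iff_mset_eq_distinct[symmetric]) auto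
    \<comment> \<open>The three cases are the corner \<open>\<nu>\<^sub>1\<close>, the corner
      \<open>\<nu>\<^sub>2\<close>, and a corner inherited from the old filler. The first two use
      the given transitions, reordered by the multiset axiom.\<close>
    consider "a = []" | "a \<noteq> []" "b = []" | "a \<noteq> []" "b \<noteq> []" by blast
    then show ?thesis
    proof cases
      case 1
      then have "mset (map u (b @ r)) = mset (Q @ R)" using m pqr by simp
      with 1 show ?thesis
        using P pqr(2) weak_hdts_multiset[OF X QR] by (simp add: e_def)
    next
      case 2
      then have "mset (map u (p @ a)) = mset (P @ Q)" using m pqr by simp
      then have "(\<alpha>, map u (p @ a), \<nu>\<^sub>2) \<in> transitions X" by (rule weak_hdts_multiset[OF X PQ])
      with 2 ab show ?thesis
        using R pqr(4) ne'(2) by (simp add: e_def)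
    next
      case 3
      then have "set a \<noteq> {}" "set a \<noteq> set q"
        using ab by (auto simp: neq_Nil_conv[of b])
      then have e: "e (set a) = c (set p \<union> set a)" by (simp add: e_def)
      have "(c {}, map u (p @ a), c (set p \<union> set a)) \<in> transitions X"
        by (rule filler_transition[OF js(3)]) (use ab js(1) pqr(1) ne' in auto)
      moreover have "(c (set p \<union> set a), map u (b @ r), c (set js)) \<in> transitions X"
        by (rule filler_transition[OF js(3)]) (use ab js(1) pqr(1) ne' in auto)
      ultimately show ?thesis using e ends by simp
    qed
  qed
  have "filler X (set q) u e"
    unfolding filler_def
  proof (intro conjI allI impI)
    fix A assume A: "A \<subseteq> set q"
    let ?a = "filter (\<lambda>i. i \<in> A) q" and ?b = "filter (\<lambda>i. i \<notin> A) q"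
    have "set ?a = A" using A by auto
    moreover have "(\<alpha>, map u (p @ ?a), e (set ?a)) \<in> transitions X"
      using through[of ?a ?b] js(1) pqr(1) by auto
    ultimately show "e A \<in> states X" using weak_hdts_transitionD(4)[OF X] by metis
  next
    fix A ks assume A: "A \<subseteq> set q \<and> ks \<noteq> [] \<and> distinct ks \<and> set ks \<subseteq> set q - A"
    define a where "a = filter (\<lambda>i. i \<in> A) q"
    define b where "b = filter (\<lambda>i. i \<notin> A \<union> set ks) q"
    have ab: "set a = A" "set b = set q - A - set ks" "distinct a" "distinct b"
      using A js(1) pqr(1) by (auto simp: a_def b_def)
    \<comment> \<open>The orders in the two paths are chosen so that both cut the same list, made of
      \<open>p @ a\<close>, then \<open>ks\<close>, then \<open>b @ r\<close>.\<close>
    have 1: "(\<alpha>, map u (p @ a), e A) \<in> transitions X"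
      "(e A, map u ((ks @ b) @ r), \<beta>) \<in> transitions X"
      using through[of a "ks @ b"] A ab by auto
    have 2: "(\<alpha>, map u (p @ (a @ ks)), e (A \<union> set ks)) \<in> transitions X"
      "(e (A \<union> set ks), map u (b @ r), \<beta>) \<in> transitions X"
      using through[of "a @ ks" b] A ab by auto
    \<comment> \<open>The long diagonal of the old filler, read in this common order.\<close>
    have "(c {}, map u ((p @ a) @ ks @ b @ r), c (set js)) \<in> transitions X"
      by (rule filler_transition[OF js(3)]) (use A ab js(1) pqr(1) ne' in auto)
    note full = this[unfolded ends]
    \<comment> \<open>Coherence of \<open>X\<close> applies even if \<open>a\<close> or
      \<open>b\<close> is empty, since \<open>p\<close> and \<open>r\<close> keep the outer segments
      nonempty. This covers the edges at the replaced corners too.\<close>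
    show "(e A, map u ks, e (A \<union> set ks)) \<in> transitions X"
      by (rule weak_hdts_coherence[OF X, of "map u (p @ a)" _ "map u (b @ r)" \<alpha> \<beta>])
        (use 1 2 A ne' full in auto)
  qed
  moreover have "e {} = \<nu>\<^sub>1" "e (set q) = \<nu>\<^sub>2" using ne'(2) by (auto simp: e_def)
  moreover have "distinct q" using js(1) pqr(1) by auto
  ultimately show ?thesis
    unfolding fillable_def using ne'(2) pqr(3) by blast
qed

section \<open>The subobject of fillable transitions\<close>

text \<open>All states are kept because each is the image of a 0-cube. The actions kept are those
  that extend to a 1-cube, which is what injectivity with respect to \<open>single_action x\<close>
  asks for.\<close>

definition fillable_part :: "('s, 'a, 'l) hdts \<Rightarrow> ('s, 'a, 'l) hdts" where
  "fillable_part X = \<lparr>states = states X, actions = {a. \<exists>\<alpha> \<beta>. (\<alpha>, [a], \<beta>) \<in> transitions X},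
     label = label X, transitions = {(\<alpha>, us, \<beta>). fillable X \<alpha> us \<beta>}\<rparr>"

lemma fillable_actions:
  assumes "fillable X \<alpha> us \<beta>" "a \<in> set us"
  shows "\<exists>\<gamma> \<delta>. (\<gamma>, [a], \<delta>) \<in> transitions X"
proof -
  from assms obtain js u c j where "filler X (set js) u c" "j \<in> set js" "a = u j"
    unfolding fillable_def by auto
  \<comment> \<open>The edge in direction \<open>j\<close> at the initial corner.\<close>
  then have "(c {}, map u [j], c {j}) \<in> transitions X"
    by (intro filler_transition) auto
  with \<open>a = u j\<close> show ?thesis by auto
qed

lemma subobject_fillable_part:
  assumes X: "weak_hdts X"
  shows "subobject (fillable_part X) X"
proof -
  have "weak_hdts (fillable_part X)"
  proof (rule weak_hdtsI)
    fix \<alpha> us \<beta> assume "(\<alpha>, us, \<beta>) \<in> transitions (fillable_part X)"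
    then have "fillable X \<alpha> us \<beta>" by (simp add: fillable_part_def)
    then show "\<alpha> \<in> states (fillable_part X) \<and> us \<noteq> [] \<and> set us \<subseteq> actions (fillable_part X)
        \<and> \<beta> \<in> states (fillable_part X)"
      using weak_hdts_transitionD[OF X fillable_transition] fillable_actions
      by (fastforce simp: fillable_part_def)
  next
    fix \<alpha> us \<beta> \<sigma> assume "(\<alpha>, us, \<beta>) \<in> transitions (fillable_part X)" "\<sigma> permutes {..<length us}"
    then show "(\<alpha>, permute_list \<sigma> us, \<beta>) \<in> transitions (fillable_part X)"
      by (simp add: fillable_part_def fillable_permute)
  next
    fix \<alpha> P Q R \<beta> \<nu>\<^sub>1 \<nu>\<^sub>2
    assume "P \<noteq> []" "Q \<noteq> []" "R \<noteq> []"
      "(\<alpha>, P @ Q @ R, \<beta>) \<in> transitions (fillable_part X)"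
      "(\<alpha>, P, \<nu>\<^sub>1) \<in> transitions (fillable_part X)" "(\<nu>\<^sub>1, Q @ R, \<beta>) \<in> transitions (fillable_part X)"
      "(\<alpha>, P @ Q, \<nu>\<^sub>2) \<in> transitions (fillable_part X)" "(\<nu>\<^sub>2, R, \<beta>) \<in> transitions (fillable_part X)"
    then show "(\<nu>\<^sub>1, Q, \<nu>\<^sub>2) \<in> transitions (fillable_part X)"
      using fillable_coherence[OF X, of P Q R \<alpha> \<beta> \<nu>\<^sub>1 \<nu>\<^sub>2]
      by (simp add: fillable_part_def fillable_transition)
  qed
  moreover have "actions (fillable_part X) \<subseteq> actions X"
    using weak_hdts_transitionD(3)[OF X] by (fastforce simp: fillable_part_def)
  ultimately show ?thesis
    using X unfolding subobject_def by (auto simp: fillable_part_def fillable_transition)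
qed


subsection \<open>Fillers versus cubes\<close>

text \<open>A set \<open>A\<close> of positions is identified with the vertex given by its indicator
  list.\<close>

lemma filler_of_cube:
  assumes f: "whdts_map (cube xs) X f"
  shows "filler X {..<length xs} (snd f \<circ> cube_action xs)
    (\<lambda>A. fst f (map (\<lambda>i. i \<in> A) [0..<length xs]))"
  unfolding filler_def
proof (intro conjI allI impI)
  fix A show "fst f (map (\<lambda>i. i \<in> A) [0..<length xs]) \<in> states X"
    using whdts_mapD(3)[OF f] by simp
next
  fix A ks assume "A \<subseteq> {..<length xs} \<and> ks \<noteq> [] \<and> distinct ks \<and> set ks \<subseteq> {..<length xs} - A"
  then have "(map (\<lambda>i. i \<in> A) [0..<length xs], map (cube_action xs) ks,
      map (\<lambda>i. i \<in> A \<union> set ks) [0..<length xs]) \<in> transitions (cube xs)"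
    unfolding cube_transition_iff by (intro exI[of _ ks]) auto
  from whdts_mapD(6)[OF f this] show "(fst f (map (\<lambda>i. i \<in> A) [0..<length xs]), map (snd f \<circ> cube_action xs) ks,
      fst f (map (\<lambda>i. i \<in> A \<union> set ks) [0..<length xs])) \<in> transitions X"
    by simp
qed

lemma fillable_cube_transition:
  assumes f: "whdts_map (cube xs) X f" and tr: "(\<epsilon>, us, \<epsilon>') \<in> transitions (cube xs)"
  shows "fillable X (fst f \<epsilon>) (map (snd f) us) (fst f \<epsilon>')"
proof -
  from tr obtain js where js: "us = map (cube_action xs) js" "length \<epsilon> = length xs"
    "length \<epsilon>' = length xs" "js \<noteq> []" "distinct js" "set js \<subseteq> {..<length xs}"
    "\<And>i. i < length xs \<Longrightarrow> \<epsilon> ! i \<le> \<epsilon>' ! i"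
    "\<And>i. i < length xs \<Longrightarrow> \<epsilon> ! i \<noteq> \<epsilon>' ! i \<longleftrightarrow> i \<in> set js"
    unfolding cube_transition_iff by blast
  \<comment> \<open>The transition is the diagonal of the face spanned by \<open>js\<close> at the
    corner \<open>A\<close> of coordinates already equal to 1 at its source.\<close>
  define A where "A = {i. i < length xs \<and> \<epsilon> ! i}"
  have "A \<subseteq> {..<length xs}" "set js \<subseteq> {..<length xs} - A"
    using js(6-8) by (force simp: A_def)+
  note fillable_face[OF filler_of_cube[OF f] this(1) js(4,5) this(2) refl]
  moreover have "map (\<lambda>i. i \<in> A) [0..<length xs] = \<epsilon>"
    using js(2) by (auto intro!: nth_equalityI simp: A_def)
  moreover have "map (\<lambda>i. i \<in> A \<union> set js) [0..<length xs] = \<epsilon>'"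
    using js(3,7,8) by (force intro!: nth_equalityI simp: A_def)
  ultimately show ?thesis using js(1) by simp
qed

text \<open>The converse of \<open>filler_of_cube\<close>, with positions renamed along
  \<open>js\<close>. The action map \<open>v\<close> is a parameter so that a prescribed map can be
  extended without altering it on actions.\<close>

lemma whdts_map_of_filler:
  assumes X: "weak_hdts X" and js: "distinct js" "length js = length xs"
    and fill: "filler X (set js) u c"
    and v: "\<And>i. i < length xs \<Longrightarrow> v (cube_action xs i) = u (js ! i)"
    and act: "\<And>i. i < length xs \<Longrightarrow> u (js ! i) \<in> actions X \<and> label X (u (js ! i)) = xs ! i"
  shows "whdts_map (cube xs) X (\<lambda>\<epsilon>. c {js ! i | i. i < length xs \<and> \<epsilon> ! i}, v)"
proof -
  let ?c = "\<lambda>\<epsilon>. c {js ! i | i. i < length xs \<and> \<epsilon> ! i}"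
  have sub: "{js ! i | i. i < length xs \<and> \<epsilon> ! i} \<subseteq> set js" for \<epsilon>
    using js(2) by auto
  have "(?c \<epsilon>, map v us, ?c \<epsilon>') \<in> transitions X" if "(\<epsilon>, us, \<epsilon>') \<in> transitions (cube xs)" for \<epsilon> us \<epsilon>'
  proof -
    from that obtain ks where ks: "us = map (cube_action xs) ks"
      "ks \<noteq> []" "distinct ks" "set ks \<subseteq> {..<length xs}"
      "\<And>i. i < length xs \<Longrightarrow> \<epsilon> ! i \<le> \<epsilon>' ! i"
      "\<And>i. i < length xs \<Longrightarrow> \<epsilon> ! i \<noteq> \<epsilon>' ! i \<longleftrightarrow> i \<in> set ks"
      unfolding cube_transition_iff by blast
    have inj: "inj_on ((!) js) {..<length xs}"
      using js by (auto simp: inj_on_def nth_eq_iff_index_eq)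
    have "(?c \<epsilon>, map u (map ((!) js) ks), ?c \<epsilon>') \<in> transitions X"
    proof (rule filler_transition[OF fill sub])
      show "map ((!) js) ks \<noteq> []" using ks(2) by simp
      show "distinct (map ((!) js) ks)"
        using ks(3,4) inj by (auto simp: distinct_map intro: inj_on_subset)
      \<comment> \<open>Where \<epsilon> and \<epsilon>' differ, the order forces \<epsilon> to be
        0, so a direction in \<open>ks\<close> is not yet used by the source vertex.\<close>
      have "js ! k \<noteq> js ! i" if "k \<in> set ks" "i < length xs" "\<epsilon> ! i" for k i
      proof
        assume "js ! k = js ! i"
        then have "k = i" using that ks(4) inj by (auto dest: inj_onD)
        then show False using that ks(5,6)[of i] by auto
      qed
      then show "set (map ((!) js) ks) \<subseteq> set js - {js ! i | i. i < length xs \<and> \<epsilon> ! i}"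
        using ks(4) js(2) by fastforce
      have *: "\<epsilon>' ! i \<longleftrightarrow> \<epsilon> ! i \<or> i \<in> set ks" if "i < length xs" for i
        using ks(5,6)[OF that] by auto
      show "{js ! i | i. i < length xs \<and> \<epsilon>' ! i} =
          {js ! i | i. i < length xs \<and> \<epsilon> ! i} \<union> set (map ((!) js) ks)"
        using * ks(4) by auto
    qed
    moreover have "map u (map ((!) js) ks) = map v us"
      using ks(1,4) v by auto
    ultimately show ?thesis by simp
  qed
  moreover have "?c \<epsilon> \<in> states X" for \<epsilon>
    using fill sub unfolding filler_def by blast
  ultimately show ?thesis
    by (intro whdts_mapI[OF weak_hdts_cube X]) (auto simp: v act)
qed


subsection \<open>Cubical transition systems and injectivity\<close>

text \<open>Every cube of \<open>X\<close> factors through \<open>fillable_part X\<close>, since its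
  transitions become faces of a filler; minimality of the union then applies.\<close>

lemma cubical_fillable:
  assumes "cubical X"
  shows "subobject X (fillable_part X)"
proof -
  have X: "weak_hdts X" using assms by (simp add: cubical_def)
  note sub = subobject_fillable_part[OF X]
  have "whdts_map (cube xs) (fillable_part X) f" if f: "whdts_map (cube xs) X f" for xs f
  proof -
    have "snd f a \<in> actions (fillable_part X)" if "a \<in> actions (cube xs)" for a
    proof -
      from that obtain i where i: "i < length xs" "a = cube_action xs i" by auto
      \<comment> \<open>The image of the edge in direction \<open>i\<close> at the vertex 0.\<close>
      have "(fst f (map (\<lambda>j. j \<in> {}) [0..<length xs]), map (snd f \<circ> cube_action xs) [i],
          fst f (map (\<lambda>j. j \<in> {i}) [0..<length xs])) \<in> transitions X"
        by (rule filler_transition[OF filler_of_cube[OF f]]) (use i(1) in auto)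
      then have "\<exists>\<gamma> \<delta>. (\<gamma>, [snd f a], \<delta>) \<in> transitions X"
        unfolding i(2) list.map comp_apply by blast
      then show ?thesis by (simp add: fillable_part_def)
    qed
    moreover have "weak_hdts (fillable_part X)" using sub by (simp add: subobject_def)
    ultimately show ?thesis
      using whdts_mapD(3,5)[OF f] fillable_cube_transition[OF f]
      by (intro whdts_mapI[OF weak_hdts_cube]) (auto simp: fillable_part_def)
  qed
  with assms sub show ?thesis unfolding cubical_iff[OF X] by blast
qed

lemma cubical_imp_injective_pure_transition:
  assumes "cubical X"
  shows "injective_wrt X (pure_transition xs) (cube xs) inclusion"
  unfolding injective_wrt_def
proof (intro allI impI)
  fix g assume g: "whdts_map (pure_transition xs) X g"
  let ?n = "length xs" and ?v = "snd g \<circ> cube_action xs"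
  have X: "weak_hdts X" using assms by (simp add: cubical_def)
  have act: "?v i \<in> actions X \<and> label X (?v i) = xs ! i" if "i < ?n" for i
    using whdts_mapD(4,5)[OF g, of "cube_action xs i"] that by simp
  \<comment> \<open>The index list may be empty here, unlike in \<open>fillable\<close>: for
    \<open>n = 0\<close> there is no transition to fill, and the constant family at the only state
    serves.\<close>
  have "\<exists>js u c. distinct js \<and> map ?v [0..<?n] = map u js \<and> filler X (set js) u c
      \<and> c {} = fst g (replicate ?n False) \<and> c (set js) = fst g (replicate ?n True)"
  proof (cases "xs = []")
    case True
    then have "filler X {} ?v (\<lambda>_. fst g [])"
      using whdts_mapD(3)[OF g] unfolding filler_def by auto
    with True show ?thesis
      by (intro exI[of _ "[]"] exI[of _ ?v] exI[of _ "\<lambda>_. fst g []"]) simp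
  next
    case False
    have "(replicate ?n False, map (\<lambda>i. cube_action xs (id i)) [0..<?n], replicate ?n True)
        \<in> transitions (pure_transition xs)"
      unfolding pure_transition_transition_iff using False permutes_id by blast
    from whdts_mapD(6)[OF g this]
    have "(fst g (replicate ?n False), map ?v [0..<?n], fst g (replicate ?n True)) \<in> transitions X"
      by (simp add: comp_def)
    then have "fillable X (fst g (replicate ?n False)) (map ?v [0..<?n]) (fst g (replicate ?n True))"
      using cubical_fillable[OF assms] by (auto simp: subobject_def fillable_part_def)
    then show ?thesis unfolding fillable_def by blast
  qed
  then obtain js u c where js: "distinct js" "map ?v [0..<?n] = map u js" "filler X (set js) u c"
    and ends: "c {} = fst g (replicate ?n False)" "c (set js) = fst g (replicate ?n True)"
    by blast
  have len: "length js = ?n" using arg_cong[OF js(2), of length] by simp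
  have v: "?v i = u (js ! i)" if "i < ?n" for i
    using arg_cong[OF js(2), of "\<lambda>l. l ! i"] that len by simp
  \<comment> \<open>Taking \<open>snd g\<close> as the action map settles agreement on actions; on
    states, only the two extreme corners remain to be compared.\<close>
  define h where "h = (\<lambda>\<epsilon>. c {js ! i | i. i < ?n \<and> \<epsilon> ! i}, snd g)"
  have "whdts_map (cube xs) X h"
    unfolding h_def by (rule whdts_map_of_filler[OF X js(1) len js(3)]) (use v act in auto)
  moreover have "fst h s = fst g s" if "s \<in> states (pure_transition xs)" for s
  proof -
    have corners: "{js ! i | i. i < ?n \<and> replicate ?n False ! i} = {}"
      "{js ! i | i. i < ?n \<and> replicate ?n True ! i} = set js"
      using len by (auto simp: set_conv_nth)
    from that consider "s = replicate ?n False" | "s = replicate ?n True" by auto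
    then show ?thesis
      by cases (simp_all only: h_def fst_conv corners ends)
  qed
  ultimately show "\<exists>h. whdts_map (cube xs) X h
      \<and> (\<forall>s\<in>states (pure_transition xs). fst h (fst inclusion s) = fst g s)
      \<and> (\<forall>a\<in>actions (pure_transition xs). snd h (snd inclusion a) = snd g a)"
    by (intro exI[of _ h]) (simp add: inclusion_def h_def)
qed

text \<open>Every action of a cubical \<open>X\<close> occurs in a 1-transition, and this edge is
  the required 1-cube. Its end states are unconstrained because \<open>single_action x\<close> has
  no states.\<close>

lemma cubical_imp_injective_single_action:
  assumes "cubical X"
  shows "injective_wrt X (single_action x) (cube [x]) inclusion"
  unfolding injective_wrt_def
proof (intro allI impI)
  fix g assume g: "whdts_map (single_action x) X g"
  have X: "weak_hdts X" using assms by (simp add: cubical_def)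
  let ?a = "snd g (cube_action [x] 0)"
  have a: "?a \<in> actions X" "label X ?a = x"
    using whdts_mapD(4,5)[OF g, of "cube_action [x] 0"] by simp_all
  moreover have "actions X \<subseteq> actions (fillable_part X)"
    using cubical_fillable[OF assms] by (simp add: subobject_def)
  ultimately obtain \<alpha> \<beta> where "(\<alpha>, [?a], \<beta>) \<in> transitions X"
    unfolding fillable_part_def by auto
  then have "fillable X \<alpha> [?a] \<beta>" by (rule fillable_single_transition[OF X])
  then obtain js u c where js: "distinct js" "[?a] = map u js" "filler X (set js) u c"
    unfolding fillable_def by metis
  then obtain j where j: "js = [j]" "u j = ?a" by auto
  have "whdts_map (cube [x]) X (\<lambda>\<epsilon>. c {js ! i | i. i < length [x] \<and> \<epsilon> ! i}, snd g)"
    by (rule whdts_map_of_filler[OF X js(1) _ js(3)]) (use a j in auto)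
  then show "\<exists>h. whdts_map (cube [x]) X h
      \<and> (\<forall>s\<in>states (single_action x). fst h (fst inclusion s) = fst g s)
      \<and> (\<forall>a\<in>actions (single_action x). snd h (snd inclusion a) = snd g a)"
    by (intro exI conjI) (assumption, simp_all add: inclusion_def)
qed

text \<open>Cubes reach everything in \<open>X\<close>: 0-cubes reach the states, and injectivity
  provides 1-cubes for the actions and \<open>n\<close>-cubes for the \<open>n\<close>-transitions.
  A subobject receiving all cubes is therefore all of \<open>X\<close>.\<close>

lemma injective_imp_cubical:
  fixes X :: "('s, 'a, 'l) hdts"
  assumes X: "weak_hdts X"
    and pure: "\<And>xs :: 'l list. injective_wrt X (pure_transition xs) (cube xs) inclusion"
    and single: "\<And>x :: 'l. injective_wrt X (single_action x) (cube [x]) inclusion"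
  shows "cubical X"
  unfolding cubical_iff[OF X]
proof (intro allI impI, elim conjE)
  fix V assume V: "subobject V X"
    and "\<forall>xs f. whdts_map (cube xs) X f \<longrightarrow> whdts_map (cube xs) V f"
  then have maps: "whdts_map (cube xs) V f" if "whdts_map (cube xs) X f" for xs f
    using that by blast
  have "s \<in> states V" if s: "s \<in> states X" for s
  proof -
    \<comment> \<open>The 0-cube has no actions, so the action map is arbitrary.\<close>
    have "whdts_map (cube []) X (\<lambda>_. s, undefined)"
      using s by (intro whdts_mapI[OF weak_hdts_cube X]) (auto simp: cube_transition_iff)
    from whdts_mapD(3)[OF maps[OF this], of "[]"] show ?thesis by simp
  qed
  moreover have "a \<in> actions V" if a: "a \<in> actions X" for a
  proof -
    define x where "x = label X a"
    have "whdts_map (single_action x) X (undefined, \<lambda>_. a)"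
      using a by (intro whdts_mapI[OF weak_hdts_single_action X]) (auto simp: x_def)
    with single[of x] obtain h where h: "whdts_map (cube [x]) X h"
      "snd h (cube_action [x] 0) = a"
      unfolding injective_wrt_def inclusion_def by fastforce
    from whdts_mapD(4)[OF maps[OF h(1)], of "cube_action [x] 0"] h(2) show ?thesis by simp
  qed
  moreover have "(\<alpha>, us, \<beta>) \<in> transitions V" if tr: "(\<alpha>, us, \<beta>) \<in> transitions X" for \<alpha> us \<beta>
  proof -
    define xs where "xs = map (label X) us"
    let ?n = "length us"
    \<comment> \<open>Actions are read off by position because \<open>us\<close> may contain
      repetitions. The two end vertices differ because \<open>us\<close> is nonempty.\<close>
    define g where "g = (\<lambda>\<epsilon>. if \<epsilon> = replicate ?n False then \<alpha> else \<beta>, \<lambda>(x :: 'l, i). us ! i)"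
    note us = weak_hdts_transitionD[OF X tr]
    have len: "length xs = ?n" by (simp add: xs_def)
    have neq: "replicate ?n True \<noteq> replicate ?n False" using us(2) by (cases us) auto
    have g: "snd g (cube_action xs i) = us ! i" for i by (simp add: g_def cube_action_def)
    \<comment> \<open>The pure transition contains all reorderings, so the multiset axiom of
      \<open>X\<close> is what makes \<open>g\<close> a map.\<close>
    have "(\<alpha>, map (\<lambda>i. us ! \<sigma> i) [0..<?n], \<beta>) \<in> transitions X" if "\<sigma> permutes {..<?n}" for \<sigma>
      using weak_hdts_multiset[OF X tr mset_permute_list[OF that]] by (simp add: permute_list_def)
    then have "(fst g \<gamma>, map (snd g) vs, fst g \<delta>) \<in> transitions X"
      if "(\<gamma>, vs, \<delta>) \<in> transitions (pure_transition xs)" for \<gamma> vs \<delta>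
      using that neq unfolding pure_transition_transition_iff
      by (auto simp: len g comp_def) (simp add: g_def)
    moreover have "snd g a \<in> actions X \<and> label X (snd g a) = fst a"
      if "a \<in> actions (pure_transition xs)" for a
      using that us(3) by (auto simp: g len) (simp add: xs_def)
    ultimately have "whdts_map (pure_transition xs) X g"
      using us(1,4) by (intro whdts_mapI[OF weak_hdts_pure_transition X]) (auto simp: g_def)
    with pure[of xs] obtain h where h: "whdts_map (cube xs) X h"
      "\<forall>s\<in>states (pure_transition xs). fst h s = fst g s"
      "\<forall>a\<in>actions (pure_transition xs). snd h a = snd g a"
      unfolding injective_wrt_def inclusion_def fst_conv snd_conv id_apply by blast
    \<comment> \<open>The long diagonal of the cube is sent by \<open>h\<close> to the given
      transition, and \<open>h\<close> takes values in \<open>V\<close>.\<close>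
    have "(replicate ?n False, map (cube_action xs) [0..<?n], replicate ?n True)
        \<in> transitions (cube xs)"
      unfolding cube_transition_iff using us(2) len by (intro exI[of _ "[0..<?n]"]) auto
    then have "(fst h (replicate ?n False), map (snd h) (map (cube_action xs) [0..<?n]),
        fst h (replicate ?n True)) \<in> transitions V"
      by (rule whdts_mapD(6)[OF maps[OF h(1)]])
    moreover have "fst h (replicate ?n False) = \<alpha>" "fst h (replicate ?n True) = \<beta>"
      using h(2) neq by (auto simp: g_def len)
    moreover have "map (snd h) (map (cube_action xs) [0..<?n]) = us"
      using h(3) by (auto intro!: nth_equalityI simp: g len)
    ultimately show ?thesis by simp
  qed
  ultimately show "subobject X V"
    using V unfolding subobject_def by auto
qed

theorem theorem3p6:
  "small_injectivity_class
     (cubical_generators ::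
        ((bool list, 'l \<times> nat, 'l) hdts \<times> (bool list, 'l \<times> nat, 'l) hdts
          \<times> (bool list, 'l \<times> nat, bool list, 'l \<times> nat) hdts_fun) set)
     {X :: ('s, 'a, 'l) hdts. cubical X}
   \<and> (\<forall>X :: ('s, 'a, 'l) hdts. weak_hdts X \<longrightarrow>
        (cubical X \<longleftrightarrow>
           (\<forall>xs :: 'l list. injective_wrt X (pure_transition xs) (cube xs) inclusion)
           \<and> (\<forall>x :: 'l. injective_wrt X (single_action x) (cube [x]) inclusion)))"
proof -
  have iff: "cubical X \<longleftrightarrow>
      (\<forall>xs :: 'l list. injective_wrt X (pure_transition xs) (cube xs) inclusion)
      \<and> (\<forall>x :: 'l. injective_wrt X (single_action x) (cube [x]) inclusion)"
    if "weak_hdts X" for X :: "('s, 'a, 'l) hdts"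
    using cubical_imp_injective_pure_transition cubical_imp_injective_single_action
      injective_imp_cubical[OF that] by (intro iffI conjI allI) simp_all
  have gen: "(\<forall>(A, B, i)\<in>cubical_generators. \<phi> A B i) \<longleftrightarrow>
      (\<forall>xs :: 'l list. \<phi> (pure_transition xs) (cube xs) inclusion)
      \<and> (\<forall>x :: 'l. \<phi> (single_action x) (cube [x]) inclusion)" for \<phi>
    by (simp add: cubical_generators_def ball_Un full_SetCompr_eq)
  have "weak_hdts X" if "cubical X" for X :: "('s, 'a, 'l) hdts"
    using that by (simp add: cubical_def)
  with iff show ?thesis
    unfolding small_injectivity_class_def gen
    using whdts_map_pure_transition_inclusion whdts_map_single_action_inclusion by blast
qed

end
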